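(* Let $X\subset\mathcal{H}(\mathbb{D})$ be a Banach space of analytic functions on the unit disk satisfying the axioms: [Ax1] all point evaluation functionals $\Lambda_z$, $z\in\mathbb{D}$, are bounded on $X$; [Ax2] the set of all polynomials in $z$ is contained in $X$ and dense in $X$ (in $\|\cdot\|_X$); [Ax3] the shift operator $S=M_z$, $Sf(z)=zf(z)$, is bounded on $X$; [Ax4] $\limsup_{n\to\infty}\|z^n\|_X^{1/n}=1$. Let $T$ be a continuous linear operator on $X$ such that, for every $\lambda\in\mathbb{C}$ with $|\lambda|=1$, the function $z-\lambda$ does not belong to $\ker T$. Then the following conditions are equivalent: (a) $T$ is a weighted composition operator; (b) there exists $\varphi\in\mathcal{H}(\mathbb{D})$ such that $\varphi(\mathbb{D})\subset\mathbb{D}$ and $M_\varphi T=TS$; (c) there exists $\varphi$, meromorphic in $\mathbb{D}$, such that $M_\varphi T=TS$; (d) there exists $\varphi$, meromorphic in $\mathbb{D}$, such that $M_{\varphi^n}T=TS^n$ for all integers $n\ge0$; (e) there exists $\varphi$, meromorphic in $\mathbb{D}$, such that $\varphi^n\cdot T1=T(z^n)$ for all integers $n\ge0$; (f) there exists $\varphi\in\mathcal{H}(\mathbb{D})$ such that $\varphi(\mathbb{D})\subset\mathbb{D}$ and $\varphi^n\cdot T1=T(z^n)$ for all integers $n\ge0$; (g) $T1\cdot T(fg)=Tf\cdot Tg$ holds for all functions $f,g\in X$ for which $fg\in X$ as well. If any of the conditions (a)-(g) is fulfilled, then $\varphi=Tz/(T1)$ is the composition symbol of $T$.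
   Context: $\mathbb{D}$ is the open unit disk and $\mathcal{H}(\mathbb{D})$ the algebra of analytic functions on it. $\Lambda_z(f)=f(z)$ for $f\in X$. A weighted composition operator on $X$ is an operator of the form $T_{F,\varphi}f=F\cdot(f\circ\varphi)$, $f\in X$, where $F\in\mathcal{H}(\mathbb{D})$ (the multiplication symbol) and $\varphi\in\mathcal{H}(\mathbb{D})$ satisfies $\varphi(\mathbb{D})\subset\mathbb{D}$ (the composition symbol; constant maps $\varphi\equiv c$, $|c|<1$, are allowed). $M_\varphi$ denotes multiplication by $\varphi$, $M_\varphi f=\varphi f$; an identity such as $M_{\varphi^n}T=TS^n$ means $\varphi^n\cdot Tf=T(S^nf)$ (as meromorphic functions in $\mathbb{D}$) for every $f\in X$. $1$, $z$ and $z^n$ denote the corresponding functions in $X$, and $T1$, $Tz$, $T(z^n)$ their images under $T$. *)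

theory Defs
  imports "HOL-Complex_Analysis.Complex_Analysis"
begin

abbreviation disk :: "complex set" where
  "disk \<equiv> ball 0 1"

text \<open>A function on the unit disk is represented by its extension by \<open>0\<close> to the whole plane, so that
  two elements of \<open>hol_disk\<close> are equal iff they agree on the disk. The set is closed under the
  pointwise operations, with zero vector \<open>\<lambda>_. 0\<close>; the constant function \<open>1\<close> is
  \<open>on_disk (\<lambda>_. 1)\<close>.\<close>

definition on_disk :: "(complex \<Rightarrow> complex) \<Rightarrow> complex \<Rightarrow> complex" where
  "on_disk f = (\<lambda>z. if z \<in> disk then f z else 0)"

definition hol_disk :: "(complex \<Rightarrow> complex) set" where
  "hol_disk = {f. f holomorphic_on disk \<and> (\<forall>z. z \<notin> disk \<longrightarrow> f z = 0)}"

definition shift :: "(complex \<Rightarrow> complex) \<Rightarrow> complex \<Rightarrow> complex" where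
  "shift f = (\<lambda>z. z * f z)"

definition hol_self_map :: "(complex \<Rightarrow> complex) \<Rightarrow> bool" where
  "hol_self_map \<phi> \<longleftrightarrow> \<phi> holomorphic_on disk \<and> \<phi> ` disk \<subseteq> disk"

definition weighted_composition_on ::
    "(complex \<Rightarrow> complex) set \<Rightarrow> ((complex \<Rightarrow> complex) \<Rightarrow> (complex \<Rightarrow> complex)) \<Rightarrow>
     (complex \<Rightarrow> complex) \<Rightarrow> (complex \<Rightarrow> complex) \<Rightarrow> bool" where
  "weighted_composition_on X T F \<phi> \<longleftrightarrow>
     F holomorphic_on disk \<and> hol_self_map \<phi> \<and>
     (\<forall>f\<in>X. \<forall>z\<in>disk. T f z = F z * f (\<phi> z))"

locale normed_disk_space =
  fixes X :: "(complex \<Rightarrow> complex) set"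
    and N :: "(complex \<Rightarrow> complex) \<Rightarrow> real"
  assumes subset_hol_disk: "X \<subseteq> hol_disk"
    and zero_mem: "(\<lambda>_. 0) \<in> X"
    and add_mem: "f \<in> X \<Longrightarrow> g \<in> X \<Longrightarrow> (\<lambda>z. f z + g z) \<in> X"
    and scale_mem: "f \<in> X \<Longrightarrow> (\<lambda>z. c * f z) \<in> X"
    and norm_nonneg: "f \<in> X \<Longrightarrow> 0 \<le> N f"
    and norm_eq_zero: "f \<in> X \<Longrightarrow> N f = 0 \<longleftrightarrow> f = (\<lambda>_. 0)"
    and norm_scale: "f \<in> X \<Longrightarrow> N (\<lambda>z. c * f z) = cmod c * N f"
    and norm_triangle: "f \<in> X \<Longrightarrow> g \<in> X \<Longrightarrow> N (\<lambda>z. f z + g z) \<le> N f + N g"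
begin

lemma diff_mem:
  assumes "f \<in> X" "g \<in> X"
  shows "(\<lambda>z. f z - g z) \<in> X"
  using add_mem[OF assms(1) scale_mem[OF assms(2), of "-1"]] by simp

lemma norm_minus_commute:
  assumes "f \<in> X" "g \<in> X"
  shows "N (\<lambda>z. f z - g z) = N (\<lambda>z. g z - f z)"
  using norm_scale[OF diff_mem[OF assms], of "-1"] by simp

text \<open>\<open>Metric_space\<close> asks for a distance that is nonnegative and symmetric everywhere, while \<open>N\<close> is
  unconstrained outside \<open>X\<close>; hence the value \<open>0\<close> off \<open>X\<close>.\<close>

definition dist_X :: "(complex \<Rightarrow> complex) \<Rightarrow> (complex \<Rightarrow> complex) \<Rightarrow> real" where
  "dist_X f g = (if f \<in> X \<and> g \<in> X then N (\<lambda>z. f z - g z) else 0)"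

sublocale Metric_space X dist_X
proof
  show "0 \<le> dist_X f g" for f g
    by (simp add: dist_X_def norm_nonneg diff_mem)
  show "dist_X f g = dist_X g f" for f g
    using norm_minus_commute[of f g] by (simp add: dist_X_def)
  show "dist_X f g = 0 \<longleftrightarrow> f = g" if "f \<in> X" "g \<in> X" for f g
    using that norm_eq_zero[OF diff_mem[OF that]] by (auto simp: dist_X_def fun_eq_iff)
  show "dist_X f h \<le> dist_X f g + dist_X g h" if "f \<in> X" "g \<in> X" "h \<in> X" for f g h
    using that norm_triangle[OF diff_mem[of f g] diff_mem[of g h]] by (simp add: dist_X_def)
qed

definition continuous_linear_operator ::
    "((complex \<Rightarrow> complex) \<Rightarrow> (complex \<Rightarrow> complex)) \<Rightarrow> bool" where
  "continuous_linear_operator T \<longleftrightarrow>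
     continuous_map mtopology mtopology T \<and>
     (\<forall>f\<in>X. \<forall>g\<in>X. T (\<lambda>z. f z + g z) = (\<lambda>z. T f z + T g z)) \<and>
     (\<forall>f\<in>X. \<forall>c. T (\<lambda>z. c * f z) = (\<lambda>z. c * T f z))"

end

locale banach_disk_space = normed_disk_space +
  assumes complete: mcomplete
    and evaluations_bounded: "z \<in> disk \<Longrightarrow> \<exists>C. \<forall>f\<in>X. cmod (f z) \<le> C * N f"
    and polynomials_mem: "on_disk (poly p) \<in> X"
    and polynomials_dense: "mtopology closure_of (range (\<lambda>p. on_disk (poly p))) = X"
    and shift_mem: "f \<in> X \<Longrightarrow> shift f \<in> X"
    and shift_bounded: "\<exists>C. \<forall>f\<in>X. N (shift f) \<le> C * N f"
    and limsup_norm_monomials: "limsup (\<lambda>n. ereal (root n (N (on_disk (\<lambda>z. z ^ n))))) = 1"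

end

theory Submission
  imports Defs
begin

text \<open>
  Every condition forces \<open>T (z ^ n) = \<phi> ^ n * T 1\<close> for a meromorphic \<open>\<phi>\<close>, up to a sparse set
  (\<open>monomial_symbol\<close>): the shift identities give it by iteration, starting from the function \<open>1\<close>, and
  the multiplicativity condition gives it with \<open>\<phi> = T z / T 1\<close>, by splitting \<open>z ^ (n + 1)\<close> into
  \<open>z * z ^ n\<close>. It remains to recover a weighted composition operator from these monomial identities.

  Fix a generic point \<open>z\<close>, with \<open>T 1 z \<noteq> 0\<close>. Evaluation at \<open>z\<close> after \<open>T\<close> is bounded, so
  \<open>|\<phi> z| ^ n * |T 1 z|\<close> is at most a constant times the norm of \<open>z ^ n\<close>. These norms grow
  subexponentially, hence \<open>|\<phi> z| \<le> 1\<close> (\<open>modulus_le_one_if_powers_bounded\<close>). A meromorphic function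
  bounded off a sparse set has only removable singularities, so \<open>\<phi>\<close> extends to a holomorphic \<open>\<psi>\<close>
  from the disk to the closed disk. If \<open>\<psi>\<close> met the unit circle, the maximum modulus principle would
  make it a unimodular constant \<open>c\<close>, and then \<open>T (z - c) = (\<psi> - c) * T 1 = 0\<close>, which the hypothesis on \<open>T\<close>
  rules out (\<open>self_map_symbol_if_monomial_symbol\<close>). The same hypothesis excludes \<open>T 1 = 0\<close>, which
  would entail \<open>T z = 0\<close>.

  So \<open>\<psi>\<close> maps the disk into itself, and for each \<open>z\<close> the functionals \<open>f \<mapsto> T f z\<close> and
  \<open>f \<mapsto> T 1 z * f (\<psi> z)\<close> are bounded and agree on monomials. Density of the polynomials makes them equal
  (\<open>weighted_composition_if_powers\<close>). The symbol is determined by the case \<open>n = 1\<close>: off a sparse set it is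
  \<open>T z / T 1\<close>.
\<close>

section \<open>Holomorphic functions off a sparse set\<close>

lemma holomorphic_eq_if_eq_cosparse:
  assumes "f holomorphic_on A" "g holomorphic_on A" "open A"
    and "\<forall>\<^sub>\<approx>z\<in>A. f z = g z" "z \<in> A"
  shows "f z = g z"
proof (rule tendsto_unique)
  have "\<forall>\<^sub>F w in at z. f w = g w"
    using assms by (simp add: eventually_cosparse_open_eq)
  moreover have "f \<midarrow>z\<rightarrow> f z" and lim: "g \<midarrow>z\<rightarrow> g z"
    using assms by (auto simp: continuous_on_eq_continuous_at isCont_def
        dest!: holomorphic_on_imp_continuous_on)
  ultimately show "g \<midarrow>z\<rightarrow> f z"
    using tendsto_cong by blast
  show "g \<midarrow>z\<rightarrow> g z" by (rule lim)
qed simp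

lemma holomorphic_nonzero_cosparse:
  assumes "f holomorphic_on A" "open A" "connected A" "z \<in> A" "f z \<noteq> 0"
  shows "\<forall>\<^sub>\<approx>z\<in>A. f z \<noteq> 0"
proof -
  have "f meromorphic_on A"
    using assms by (simp add: analytic_on_imp_meromorphic_on analytic_on_open)
  moreover have "\<not> (\<forall>\<^sub>\<approx>z\<in>A. f z = 0)"
    using holomorphic_eq_if_eq_cosparse[OF assms(1) holomorphic_on_const[of 0] assms(2) _ assms(4)] assms(5)
    by blast
  ultimately show ?thesis
    using meromorphic_imp_constant_or_avoid assms by blast
qed

text \<open>Riemann's theorem on removable singularities: removing them leaves only poles, where the
  function would be unbounded. The bound passes to the exceptional points by continuity.\<close>

lemma bounded_meromorphic_extends:
  assumes "\<phi> meromorphic_on A" "open A" and bound: "\<forall>\<^sub>\<approx>z\<in>A. cmod (\<phi> z) \<le> B"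
  obtains \<psi> where "\<psi> holomorphic_on A" "\<And>z. z \<in> A \<Longrightarrow> cmod (\<psi> z) \<le> B"
    "\<forall>\<^sub>\<approx>z\<in>A. \<psi> z = \<phi> z"
proof
  let ?\<psi> = "remove_sings \<phi>"
  show eq: "\<forall>\<^sub>\<approx>z\<in>A. ?\<psi> z = \<phi> z"
    using eventually_remove_sings_eq[OF assms(1)] .
  have bound': "\<forall>\<^sub>\<approx>z\<in>A. cmod (?\<psi> z) \<le> B"
    using eventually_conj[OF eq bound] by (rule eventually_mono) auto
  have "?\<psi> nicely_meromorphic_on A"
    using assms(1) by (rule remove_sings_nicely_meromorphic)
  moreover have "\<not> is_pole ?\<psi> z" if "z \<in> A" for z
  proof
    assume "is_pole ?\<psi> z"
    then have "\<forall>\<^sub>F w in at z. cmod (?\<psi> w) > B"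
      unfolding is_pole_def filterlim_at_infinity_conv_norm_at_top filterlim_at_top_dense by blast
    moreover have "\<forall>\<^sub>F w in at z. cmod (?\<psi> w) \<le> B"
      using bound' \<open>open A\<close> that by (simp add: eventually_cosparse_open_eq)
    ultimately have "\<forall>\<^sub>F w in at z. False"
      by eventually_elim auto
    then show False by simp
  qed
  ultimately have an: "?\<psi> analytic_on {z}" if "z \<in> A" for z
    using that nicely_meromorphic_on_imp_analytic_at by blast
  then show "?\<psi> holomorphic_on A"
    by (meson analytic_imp_holomorphic analytic_on_analytic_at)
  show "cmod (?\<psi> z) \<le> B" if "z \<in> A" for z
  proof (rule tendsto_upperbound)
    show "((\<lambda>w. cmod (?\<psi> w)) \<longlongrightarrow> cmod (?\<psi> z)) (at z)"
      using analytic_at_imp_isCont[OF an[OF that]] by (intro tendsto_norm) (simp add: isCont_def)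
    show "\<forall>\<^sub>F w in at z. cmod (?\<psi> w) \<le> B"
      using bound' \<open>open A\<close> that by (simp add: eventually_cosparse_open_eq)
  qed simp
qed

section \<open>Monomials in the Banach space\<close>

lemma on_disk_monomial_eq_poly: "on_disk (\<lambda>z. z ^ n) = on_disk (poly (monom 1 n))"
  by (simp add: poly_monom fun_eq_iff on_disk_def)

lemma shift_power_on_disk_one: "(shift ^^ n) (on_disk (\<lambda>_. 1)) = on_disk (\<lambda>z. z ^ n)"
  by (induction n) (auto simp: shift_def on_disk_def fun_eq_iff)

context banach_disk_space
begin

lemma monomial_mem: "on_disk (\<lambda>z. z ^ n) \<in> X"
  unfolding on_disk_monomial_eq_poly by (rule polynomials_mem)

lemma shift_power_mem: "f \<in> X \<Longrightarrow> (shift ^^ n) f \<in> X"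
  by (induction n) (auto intro: shift_mem)

text \<open>Bounded functionals are determined on the dense subspace of polynomials. This is how an
  identity known for monomials reaches the whole space.\<close>

lemma eq_zero_if_zero_on_monomials:
  fixes L :: "(complex \<Rightarrow> complex) \<Rightarrow> complex"
  assumes add: "\<And>f g. f \<in> X \<Longrightarrow> g \<in> X \<Longrightarrow> L (\<lambda>z. f z + g z) = L f + L g"
    and scale: "\<And>f c. f \<in> X \<Longrightarrow> L (\<lambda>z. c * f z) = c * L f"
    and bound: "\<And>f. f \<in> X \<Longrightarrow> cmod (L f) \<le> C * N f"
    and monomials: "\<And>n. L (on_disk (\<lambda>z. z ^ n)) = 0"
    and f: "f \<in> X"
  shows "L f = 0"
proof -
  have monom: "L (on_disk (poly (monom a n))) = 0" for a n
  proof -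
    have "on_disk (poly (monom a n)) = (\<lambda>z. a * on_disk (\<lambda>z. z ^ n) z)"
      by (auto simp: on_disk_def poly_monom)
    then show ?thesis
      by (simp add: scale monomial_mem monomials)
  qed
  have "L (on_disk (poly (\<Sum>i\<le>n. monom (coeff p i) i))) = 0" for p n
  proof (induction n)
    case 0
    then show ?case using monom[of _ 0] by simp
  next
    case (Suc n)
    let ?q = "\<Sum>i\<le>n. monom (coeff p i) i" and ?m = "monom (coeff p (Suc n)) (Suc n)"
    have "on_disk (poly (?q + ?m)) = (\<lambda>z. on_disk (poly ?q) z + on_disk (poly ?m) z)"
      by (auto simp: on_disk_def)
    then have "L (on_disk (poly (?q + ?m))) = L (on_disk (poly ?q)) + L (on_disk (poly ?m))"
      by (simp only: add polynomials_mem)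
    then show ?case
      by (simp only: sum.atMost_Suc Suc monom add_0_left)
  qed
  from this[of _ "degree _"] have poly: "L (on_disk (poly p)) = 0" for p
    by (metis poly_as_sum_of_monoms)
  \<comment> \<open>Since \<open>L\<close> kills polynomials, it sees only the error of a polynomial approximation to \<open>f\<close>.\<close>
  have small: "cmod (L f) \<le> \<bar>C\<bar> * r" if "r > 0" for r
  proof -
    have "f \<in> mtopology closure_of (range (\<lambda>p. on_disk (poly p)))"
      using f polynomials_dense by simp
    then obtain p where p: "dist_X f (on_disk (poly p)) < r"
      unfolding metric_closure_of using \<open>r > 0\<close> by (auto simp: mball_def)
    let ?d = "\<lambda>z. f z - on_disk (poly p) z"
    have d: "?d \<in> X" "N ?d < r"
      using p f polynomials_mem diff_mem by (auto simp: dist_X_def)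
    have "L f = L (\<lambda>z. ?d z + on_disk (poly p) z)" by simp
    also have "\<dots> = L ?d"
      using d(1) by (subst add) (auto simp: polynomials_mem poly)
    finally have "cmod (L f) \<le> C * N ?d" using bound d(1) by simp
    also have "\<dots> \<le> \<bar>C\<bar> * r"
      using d by (intro mult_mono) (auto simp: norm_nonneg)
    finally show ?thesis .
  qed
  have "cmod (L f) \<le> 0 + e" if "e > 0" for e
  proof -
    have "cmod (L f) \<le> \<bar>C\<bar> * (e / (\<bar>C\<bar> + 1))"
      using that by (intro small) (simp add: add_nonneg_pos)
    also have "\<dots> \<le> e"
      using that by (simp add: field_simps)
    finally show ?thesis by simp
  qed
  then have "cmod (L f) \<le> 0"
    by (rule field_le_epsilon)
  then show ?thesis
    by simp
qed

text \<open>The root test for the growth axiom; \<open>n = 0\<close> is excluded in the proof because \<open>root 0\<close> is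
  constantly \<open>0\<close>.\<close>

lemma norm_monomials_subexponential:
  assumes "r > 1"
  shows "\<forall>\<^sub>F n in sequentially. N (on_disk (\<lambda>z. z ^ n)) \<le> r ^ n"
proof -
  have "\<forall>\<^sub>F n in sequentially. ereal (root n (N (on_disk (\<lambda>z. z ^ n)))) < ereal r"
    using assms limsup_norm_monomials by (intro Limsup_lessD) simp
  then show ?thesis
    using eventually_gt_at_top[of 0]
  proof eventually_elim
    case (elim n)
    have "N (on_disk (\<lambda>z. z ^ n)) = root n (N (on_disk (\<lambda>z. z ^ n))) ^ n"
      using elim(2) by (simp add: norm_nonneg monomial_mem)
    also have "\<dots> \<le> r ^ n"
      using elim by (intro power_mono) (auto simp: norm_nonneg monomial_mem)
    finally show ?case .
  qed
qed

text \<open>If \<open>|w| > r > 1\<close>, then \<open>|w| ^ n\<close> outgrows \<open>r ^ n\<close>, which eventually dominates the norm of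
  \<open>z ^ n\<close>. In the application \<open>w\<close> and \<open>a\<close> are the values of the symbol and of \<open>T 1\<close> at a point.\<close>

lemma modulus_le_one_if_powers_bounded:
  assumes bound: "\<And>n. cmod (w ^ n * a) \<le> C * N (on_disk (\<lambda>z. z ^ n))" and "a \<noteq> 0"
  shows "cmod w \<le> 1"
proof (rule ccontr)
  assume "\<not> cmod w \<le> 1"
  then obtain r where r: "1 < r" "r < cmod w"
    using dense[of 1 "cmod w"] by auto
  have "filterlim (\<lambda>n. (cmod w / r) ^ n) at_infinity sequentially"
    using r by (intro filterlim_realpow_sequentially_gt1) auto
  then have "\<forall>\<^sub>F n in sequentially. (cmod w / r) ^ n > \<bar>C\<bar> / cmod a"
    using r by (simp add: filterlim_at_infinity_conv_norm_at_top filterlim_at_top_dense norm_power)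
  with norm_monomials_subexponential[OF r(1)] have "\<forall>\<^sub>F n in sequentially. False"
  proof eventually_elim
    case (elim n)
    have "cmod w ^ n * cmod a \<le> C * N (on_disk (\<lambda>z. z ^ n))"
      using bound[of n] by (simp add: norm_mult norm_power)
    also have "\<dots> \<le> \<bar>C\<bar> * r ^ n"
      using elim by (intro mult_mono) (auto simp: norm_nonneg monomial_mem)
    also have "\<dots> < (cmod w / r) ^ n * cmod a * r ^ n"
      using elim r \<open>a \<noteq> 0\<close> by (simp add: field_simps)
    also have "\<dots> = cmod w ^ n * cmod a"
      using r by (simp add: power_divide)
    finally show False by simp
  qed
  then show False by simp
qed

end

section \<open>Continuous operators on the space\<close>

locale disk_space_operator = banach_disk_space +
  fixes T :: "(complex \<Rightarrow> complex) \<Rightarrow> complex \<Rightarrow> complex"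
  assumes operator: "continuous_linear_operator T"
begin

lemma operator_add: "f \<in> X \<Longrightarrow> g \<in> X \<Longrightarrow> T (\<lambda>z. f z + g z) = (\<lambda>z. T f z + T g z)"
  using operator by (simp add: continuous_linear_operator_def)

lemma operator_scale: "f \<in> X \<Longrightarrow> T (\<lambda>z. c * f z) = (\<lambda>z. c * T f z)"
  using operator by (simp add: continuous_linear_operator_def)

lemma operator_mem: "f \<in> X \<Longrightarrow> T f \<in> X"
  using operator unfolding continuous_linear_operator_def continuous_map_def by auto

lemma operator_holomorphic: "f \<in> X \<Longrightarrow> T f holomorphic_on disk"
  using operator_mem subset_hol_disk by (auto simp: hol_disk_def)

lemma operator_zero_off_disk: "f \<in> X \<Longrightarrow> z \<notin> disk \<Longrightarrow> T f z = 0"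
  using operator_mem subset_hol_disk by (auto simp: hol_disk_def)

lemma operator_bounded: obtains K where "\<And>f. f \<in> X \<Longrightarrow> N (T f) \<le> K * N f"
proof -
  \<comment> \<open>Continuity at the zero function turns into a bound by rescaling to norm \<open>\<delta> / 2\<close>.\<close>
  let ?o = "\<lambda>_::complex. 0::complex"
  have T0: "T ?o = ?o"
    using operator_scale[OF zero_mem, of 0] by simp
  have dist0: "dist_X ?o f = N f" if "f \<in> X" for f
    using that by (subst commute) (simp add: dist_X_def zero_mem)
  have "\<exists>\<delta>>0. \<forall>f. f \<in> X \<and> dist_X ?o f < \<delta> \<longrightarrow> dist_X (T ?o) (T f) < 1"
    using operator zero_mem
    unfolding continuous_linear_operator_def metric_continuous_map[OF Metric_space_axioms]
    by (auto dest!: bspec[of _ _ ?o])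
  then obtain \<delta> where "\<delta> > 0" and \<delta>: "\<And>f. f \<in> X \<Longrightarrow> N f < \<delta> \<Longrightarrow> N (T f) < 1"
    using T0 dist0 operator_mem by auto
  have "N (T f) \<le> 2 / \<delta> * N f" if f: "f \<in> X" for f
  proof (cases "N f = 0")
    case True
    then have "f = ?o" using norm_eq_zero f by blast
    then show ?thesis using T0 norm_eq_zero[OF zero_mem] by simp
  next
    case False
    then have pos: "N f > 0" using norm_nonneg[OF f] by simp
    define c where "c = complex_of_real (\<delta> / (2 * N f))"
    have c: "cmod c = \<delta> / (2 * N f)"
      using pos \<open>\<delta> > 0\<close> by (simp add: c_def norm_divide norm_mult)
    have "N (\<lambda>z. c * f z) < \<delta>"
      using pos \<open>\<delta> > 0\<close> by (simp add: norm_scale f c)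
    then have "cmod c * N (T f) < 1"
      using \<delta>[OF scale_mem[OF f, of c]] by (simp add: operator_scale f norm_scale operator_mem)
    then show ?thesis
      using pos \<open>\<delta> > 0\<close> by (simp add: c field_simps)
  qed
  then show thesis by (rule that)
qed

lemma evaluation_after_operator_bounded:
  assumes "z \<in> disk"
  obtains C where "\<And>f. f \<in> X \<Longrightarrow> cmod (T f z) \<le> C * N f"
proof -
  obtain K where K: "\<And>f. f \<in> X \<Longrightarrow> N (T f) \<le> K * N f"
    using operator_bounded by blast
  obtain C where C: "\<And>f. f \<in> X \<Longrightarrow> cmod (f z) \<le> C * N f"
    using evaluations_bounded[OF assms] by blast
  have "cmod (T f z) \<le> (\<bar>C\<bar> * K) * N f" if "f \<in> X" for f
  proof -
    have "cmod (T f z) \<le> \<bar>C\<bar> * N (T f)"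
      using C[OF operator_mem[OF that]] norm_nonneg[OF operator_mem[OF that]]
      by (meson abs_ge_self mult_right_mono order_trans)
    also have "\<dots> \<le> \<bar>C\<bar> * (K * N f)"
      using K[OF that] by (intro mult_left_mono) auto
    finally show ?thesis by (simp add: mult.assoc)
  qed
  then show thesis by (rule that)
qed

abbreviation T1 where "T1 \<equiv> T (on_disk (\<lambda>_. 1))"
abbreviation Tz where "Tz \<equiv> T (on_disk (\<lambda>z. z))"

lemma one_mem: "on_disk (\<lambda>_. 1) \<in> X"
  using monomial_mem[of 0] by simp

lemma ident_mem: "on_disk (\<lambda>z. z) \<in> X"
  using monomial_mem[of 1] by simp

lemma operator_linear_factor: "T (on_disk (\<lambda>z. z - c)) = (\<lambda>z. Tz z - c * T1 z)"
proof -
  have "on_disk (\<lambda>z. z - c) = (\<lambda>z. on_disk (\<lambda>z. z) z + (- c) * on_disk (\<lambda>_. 1) z)"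
    by (auto simp: on_disk_def)
  then show ?thesis
    using operator_add[OF ident_mem scale_mem[OF one_mem, of "- c"]] operator_scale[OF one_mem, of "-c"]
    by simp
qed

text \<open>Formally the weakest of the conditions that mention a symbol. Only agreement off a sparse set is asked,
  since a meromorphic function has arbitrary values at its poles.\<close>

definition monomial_symbol :: "(complex \<Rightarrow> complex) \<Rightarrow> bool" where
  "monomial_symbol \<phi> \<longleftrightarrow> \<phi> meromorphic_on disk \<and>
     (\<forall>n. \<forall>\<^sub>\<approx>z\<in>disk. \<phi> z ^ n * T1 z = T (on_disk (\<lambda>w. w ^ n)) z)"

text \<open>At each point both sides of the formula for \<open>T\<close> are bounded functionals of \<open>f\<close>, and the
  hypothesis says that they agree on monomials. That \<open>\<psi>\<close> maps into the open disk is what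
  makes \<open>f \<mapsto> f (\<psi> z)\<close> a bounded functional.\<close>

lemma weighted_composition_if_powers:
  assumes "hol_self_map \<psi>"
    and powers: "\<And>n z. z \<in> disk \<Longrightarrow> \<psi> z ^ n * T1 z = T (on_disk (\<lambda>w. w ^ n)) z"
  shows "weighted_composition_on X T T1 \<psi>"
  unfolding weighted_composition_on_def
proof (intro conjI ballI)
  show "T1 holomorphic_on disk" by (rule operator_holomorphic[OF one_mem])
  show "hol_self_map \<psi>" by fact
  fix f z assume f: "f \<in> X" and z: "z \<in> disk"
  define w where "w = \<psi> z"
  have w: "w \<in> disk" using assms(1) z unfolding hol_self_map_def w_def by blast
  obtain C where C: "\<And>f. f \<in> X \<Longrightarrow> cmod (T f z) \<le> C * N f"
    using evaluation_after_operator_bounded[OF z] by blast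
  obtain D where D: "\<And>f. f \<in> X \<Longrightarrow> cmod (f w) \<le> D * N f"
    using evaluations_bounded[OF w] by blast
  define L where "L f = T f z - T1 z * f w" for f
  have "L f = 0"
  proof (rule eq_zero_if_zero_on_monomials[OF _ _ _ _ f])
    show "L (\<lambda>z. f z + g z) = L f + L g" if "f \<in> X" "g \<in> X" for f g
      using that by (simp add: L_def operator_add algebra_simps)
    show "L (\<lambda>z. c * f z) = c * L f" if "f \<in> X" for f c
      using that by (simp add: L_def operator_scale algebra_simps)
    show "cmod (L f) \<le> (C + cmod (T1 z) * D) * N f" if "f \<in> X" for f
    proof -
      have "cmod (L f) \<le> cmod (T f z) + cmod (T1 z) * cmod (f w)"
        unfolding L_def using norm_triangle_ineq4[of "T f z" "T1 z * f w"] by (simp add: norm_mult)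
      also have "\<dots> \<le> C * N f + cmod (T1 z) * (D * N f)"
        using C[OF that] D[OF that] by (intro add_mono mult_left_mono) auto
      finally show ?thesis by (simp add: algebra_simps)
    qed
    show "L (on_disk (\<lambda>z. z ^ n)) = 0" for n
      using powers[OF z, of n] w by (simp add: L_def on_disk_def w_def[symmetric] mult.commute)
  qed
  then show "T f z = T1 z * f (\<psi> z)" by (simp add: L_def w_def)
qed

end

locale nonvanishing_disk_space_operator = disk_space_operator +
  assumes unimodular: "cmod c = 1 \<Longrightarrow> T (on_disk (\<lambda>z. z - c)) \<noteq> (\<lambda>_. 0)"
begin

text \<open>Were \<open>T 1\<close> to vanish, the symbol identity for \<open>n = 1\<close> would give \<open>T z = 0\<close>, and \<open>z - 1\<close> would be
  in the kernel.\<close>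

lemma image_one_nonzero:
  assumes "monomial_symbol \<phi>"
  shows "T1 \<noteq> (\<lambda>_. 0)"
proof
  assume T1: "T1 = (\<lambda>_. 0)"
  have "\<forall>\<^sub>\<approx>z\<in>disk. \<phi> z ^ 1 * T1 z = T (on_disk (\<lambda>w. w ^ 1)) z"
    using assms unfolding monomial_symbol_def by blast
  then have "\<forall>\<^sub>\<approx>z\<in>disk. Tz z = 0"
    by eventually_elim (simp add: T1)
  then have "Tz z = 0" if "z \<in> disk" for z
    using that by (intro holomorphic_eq_if_eq_cosparse[of Tz disk "\<lambda>_. 0"])
      (auto intro: operator_holomorphic ident_mem)
  then have "T (on_disk (\<lambda>z. z - 1)) = (\<lambda>_. 0)"
    using operator_zero_off_disk[OF ident_mem] T1
    by (force simp: operator_linear_factor fun_eq_iff)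
  then show False using unimodular[of 1] by simp
qed

lemma image_one_nonzero_cosparse:
  assumes "T1 \<noteq> (\<lambda>_. 0)"
  shows "\<forall>\<^sub>\<approx>z\<in>disk. T1 z \<noteq> 0"
proof -
  obtain z where "T1 z \<noteq> 0" using assms by auto
  moreover from this have "z \<in> disk"
    using operator_zero_off_disk[OF one_mem] by blast
  ultimately show ?thesis
    by (intro holomorphic_nonzero_cosparse operator_holomorphic one_mem) auto
qed

text \<open>The case \<open>n = 1\<close> alone determines the symbol.\<close>

lemma monomial_symbol_eq_quotient:
  assumes "monomial_symbol \<phi>"
  shows "\<forall>\<^sub>\<approx>z\<in>disk. \<phi> z = Tz z / T1 z"
proof -
  have "\<forall>\<^sub>\<approx>z\<in>disk. \<phi> z ^ 1 * T1 z = T (on_disk (\<lambda>w. w ^ 1)) z"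
    using assms unfolding monomial_symbol_def by blast
  with image_one_nonzero_cosparse[OF image_one_nonzero[OF assms]] show ?thesis
    by eventually_elim (simp add: field_simps)
qed

text \<open>The modulus estimate needs all powers at one and the same point, whereas the exceptional set in
  the symbol identity depends on \<open>n\<close>. Clearing denominators in \<open>\<phi> = T z / T 1\<close> gives identities
  between holomorphic functions, which hold at every point of the disk; dividing again leaves as
  exceptions only the zeros of \<open>T 1\<close> and the points where \<open>\<phi>\<close> differs from the quotient.\<close>

lemma monomial_symbol_bounded:
  assumes "monomial_symbol \<phi>"
  shows "\<forall>\<^sub>\<approx>z\<in>disk. cmod (\<phi> z) \<le> 1"
proof -
  define \<psi> where "\<psi> z = Tz z / T1 z" for z
  have T1: "\<forall>\<^sub>\<approx>z\<in>disk. T1 z \<noteq> 0"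
    using image_one_nonzero_cosparse image_one_nonzero[OF assms] .
  have quot: "\<forall>\<^sub>\<approx>z\<in>disk. \<phi> z = \<psi> z"
    using monomial_symbol_eq_quotient[OF assms] by (simp add: \<psi>_def)
  have powers: "Tz z ^ n * T1 z = T1 z ^ n * T (on_disk (\<lambda>w. w ^ n)) z" if "z \<in> disk" for z n
  proof (rule holomorphic_eq_if_eq_cosparse[OF _ _ _ _ that])
    have "\<forall>\<^sub>\<approx>z\<in>disk. \<phi> z ^ n * T1 z = T (on_disk (\<lambda>w. w ^ n)) z"
      using assms unfolding monomial_symbol_def by blast
    with T1 quot show "\<forall>\<^sub>\<approx>z\<in>disk. Tz z ^ n * T1 z = T1 z ^ n * T (on_disk (\<lambda>w. w ^ n)) z"
    proof eventually_elim
      case (elim z)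
      have "Tz z = \<phi> z * T1 z" using elim by (simp add: \<psi>_def)
      then show ?case by (simp add: power_mult_distrib flip: elim(3))
    qed
  qed (auto intro!: holomorphic_intros operator_holomorphic one_mem ident_mem monomial_mem)
  have "\<forall>\<^sub>\<approx>z\<in>disk. z \<in> disk"
    by (rule eventually_in_cosparse) auto
  with T1 quot show ?thesis
  proof eventually_elim
    case (elim z)
    obtain C where C: "\<And>f. f \<in> X \<Longrightarrow> cmod (T f z) \<le> C * N f"
      using evaluation_after_operator_bounded elim(3) by blast
    have "\<phi> z ^ n * T1 z = T (on_disk (\<lambda>w. w ^ n)) z" for n
      using powers[OF elim(3), of n] elim(1) by (simp add: elim(2) \<psi>_def field_simps)
    then show ?case
      using C monomial_mem elim(1) by (intro modulus_le_one_if_powers_bounded[of _ "T1 z" C]) auto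
  qed
qed

text \<open>The holomorphic extension of the symbol has modulus at most \<open>1\<close>. It attains \<open>1\<close> only if it is a
  unimodular constant \<open>c\<close>, and then \<open>z - c\<close> is in the kernel of \<open>T\<close>.\<close>

lemma self_map_symbol_if_monomial_symbol:
  assumes "monomial_symbol \<phi>"
  obtains \<psi> where "hol_self_map \<psi>"
    "\<And>n z. z \<in> disk \<Longrightarrow> \<psi> z ^ n * T1 z = T (on_disk (\<lambda>w. w ^ n)) z"
proof -
  have mero: "\<phi> meromorphic_on disk"
    using assms unfolding monomial_symbol_def by blast
  then obtain \<psi> where hol: "\<psi> holomorphic_on disk" and le: "\<And>z. z \<in> disk \<Longrightarrow> cmod (\<psi> z) \<le> 1"
    and eq: "\<forall>\<^sub>\<approx>z\<in>disk. \<psi> z = \<phi> z"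
    using bounded_meromorphic_extends[OF _ open_ball monomial_symbol_bounded[OF assms]] by blast
  have powers: "\<psi> z ^ n * T1 z = T (on_disk (\<lambda>w. w ^ n)) z" if "z \<in> disk" for n z
  proof (rule holomorphic_eq_if_eq_cosparse[OF _ _ _ _ that])
    have "\<forall>\<^sub>\<approx>z\<in>disk. \<phi> z ^ n * T1 z = T (on_disk (\<lambda>w. w ^ n)) z"
      using assms unfolding monomial_symbol_def by blast
    with eq show "\<forall>\<^sub>\<approx>z\<in>disk. \<psi> z ^ n * T1 z = T (on_disk (\<lambda>w. w ^ n)) z"
      by eventually_elim simp
  qed (auto intro!: holomorphic_intros hol operator_holomorphic one_mem monomial_mem)
  have "cmod (\<psi> z) < 1" if z: "z \<in> disk" for z
  proof (rule ccontr)
    assume "\<not> cmod (\<psi> z) < 1"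
    with le[OF z] have 1: "cmod (\<psi> z) = 1" by simp
    have "\<psi> constant_on disk"
      by (rule maximum_modulus_principle[OF hol _ _ open_ball order_refl z]) (use le 1 in auto)
    then have const: "\<psi> w = \<psi> z" if "w \<in> disk" for w
      using that z unfolding constant_on_def by metis
    have "Tz w - \<psi> z * T1 w = 0" for w
    proof (cases "w \<in> disk")
      case True
      then show ?thesis using powers[of w 1] const by simp
    next
      case False
      then show ?thesis by (simp add: operator_zero_off_disk one_mem ident_mem)
    qed
    then show False using unimodular[OF 1] by (simp add: operator_linear_factor)
  qed
  then have "hol_self_map \<psi>" using hol by (auto simp: hol_self_map_def)
  with powers show thesis using that by blast
qed

text \<open>Apply multiplicativity to \<open>z * z ^ n\<close> and induct on \<open>n\<close>. If \<open>T 1\<close> vanished, the product \<open>z * z\<close>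
  would give \<open>(T z)\<^sup>2 = 0\<close>, and again \<open>z - 1\<close> would be in the kernel.\<close>

lemma quotient_monomial_symbol_if_multiplicative:
  assumes mult: "\<And>f h z. f \<in> X \<Longrightarrow> h \<in> X \<Longrightarrow> (\<lambda>z. f z * h z) \<in> X \<Longrightarrow> z \<in> disk \<Longrightarrow>
      T1 z * T (\<lambda>w. f w * h w) z = T f z * T h z"
  shows "monomial_symbol (\<lambda>z. Tz z / T1 z)"
proof -
  have prod: "(\<lambda>z. on_disk (\<lambda>w. w) z * on_disk (\<lambda>w. w ^ n) z) = on_disk (\<lambda>w. w ^ Suc n)" for n
    by (auto simp: on_disk_def)
  have step: "T1 z * T (on_disk (\<lambda>w. w ^ Suc n)) z = Tz z * T (on_disk (\<lambda>w. w ^ n)) z"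
    if "z \<in> disk" for z n
    using mult[OF ident_mem monomial_mem _ that, of n] monomial_mem[of "Suc n"]
    unfolding prod by blast
  have "T1 \<noteq> (\<lambda>_. 0)"
  proof
    assume T1: "T1 = (\<lambda>_. 0)"
    have "Tz z - 1 * T1 z = 0" for z
    proof (cases "z \<in> disk")
      case True
      then show ?thesis using step[of z 1] by (simp add: T1)
    qed (simp add: operator_zero_off_disk one_mem ident_mem)
    then show False using unimodular[of 1] by (simp add: operator_linear_factor)
  qed
  then have nz: "\<forall>\<^sub>\<approx>z\<in>disk. T1 z \<noteq> 0" by (rule image_one_nonzero_cosparse)
  have disk: "\<forall>\<^sub>\<approx>z\<in>disk. z \<in> disk"
    by (rule eventually_in_cosparse) auto
  have "(\<lambda>z. Tz z / T1 z) meromorphic_on disk"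
    by (intro meromorphic_intros analytic_on_imp_meromorphic_on)
      (auto simp: analytic_on_open operator_holomorphic one_mem ident_mem)
  moreover have "\<forall>\<^sub>\<approx>z\<in>disk. (Tz z / T1 z) ^ n * T1 z = T (on_disk (\<lambda>w. w ^ n)) z" for n
    using nz disk
  proof eventually_elim
    case (elim z)
    show ?case
    proof (induction n)
      case 0
      then show ?case by simp
    next
      case (Suc n)
      then show ?case
        using step[OF elim(2), of n] elim(1) by (simp add: field_simps)
    qed
  qed
  ultimately show ?thesis by (simp add: monomial_symbol_def)
qed

end

theorem theorem4:
  fixes X :: "(complex \<Rightarrow> complex) set"
    and N :: "(complex \<Rightarrow> complex) \<Rightarrow> real"
    and T :: "(complex \<Rightarrow> complex) \<Rightarrow> (complex \<Rightarrow> complex)"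
  assumes "banach_disk_space X N"
    and "normed_disk_space.continuous_linear_operator X N T"
    and "\<And>c. cmod c = 1 \<Longrightarrow> T (on_disk (\<lambda>z. z - c)) \<noteq> (\<lambda>_. 0)"
  shows
    "let T1 = T (on_disk (\<lambda>_. 1));
         Tz = T (on_disk (\<lambda>z. z));
         A = (\<lambda>\<phi>. \<exists>F. weighted_composition_on X T F \<phi>);
         B = (\<lambda>\<phi>. hol_self_map \<phi> \<and> (\<forall>f\<in>X. \<forall>z\<in>disk. \<phi> z * T f z = T (shift f) z));
         C = (\<lambda>\<phi>. \<phi> meromorphic_on disk \<and>
                (\<forall>f\<in>X. \<forall>\<^sub>\<approx>z\<in>disk. \<phi> z * T f z = T (shift f) z));
         D = (\<lambda>\<phi>. \<phi> meromorphic_on disk \<and>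
                (\<forall>n. \<forall>f\<in>X. \<forall>\<^sub>\<approx>z\<in>disk. \<phi> z ^ n * T f z = T ((shift ^^ n) f) z));
         E = (\<lambda>\<phi>. \<phi> meromorphic_on disk \<and>
                (\<forall>n. \<forall>\<^sub>\<approx>z\<in>disk. \<phi> z ^ n * T1 z = T (on_disk (\<lambda>w. w ^ n)) z));
         F = (\<lambda>\<phi>. hol_self_map \<phi> \<and>
                (\<forall>n. \<forall>z\<in>disk. \<phi> z ^ n * T1 z = T (on_disk (\<lambda>w. w ^ n)) z));
         G = (\<forall>f\<in>X. \<forall>h\<in>X. (\<lambda>z. f z * h z) \<in> X \<longrightarrow>
                (\<forall>z\<in>disk. T1 z * T (\<lambda>w. f w * h w) z = T f z * T h z))
     in ((\<exists>\<phi>. A \<phi>) \<longleftrightarrow> (\<exists>\<phi>. B \<phi>)) \<and>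
        ((\<exists>\<phi>. A \<phi>) \<longleftrightarrow> (\<exists>\<phi>. C \<phi>)) \<and>
        ((\<exists>\<phi>. A \<phi>) \<longleftrightarrow> (\<exists>\<phi>. D \<phi>)) \<and>
        ((\<exists>\<phi>. A \<phi>) \<longleftrightarrow> (\<exists>\<phi>. E \<phi>)) \<and>
        ((\<exists>\<phi>. A \<phi>) \<longleftrightarrow> (\<exists>\<phi>. F \<phi>)) \<and>
        ((\<exists>\<phi>. A \<phi>) \<longleftrightarrow> G) \<and>
        ((\<exists>\<phi>. A \<phi>) \<or> (\<exists>\<phi>. B \<phi>) \<or> (\<exists>\<phi>. C \<phi>) \<or> (\<exists>\<phi>. D \<phi>) \<or>
           (\<exists>\<phi>. E \<phi>) \<or> (\<exists>\<phi>. F \<phi>) \<or> G \<longrightarrow>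
           T1 \<noteq> (\<lambda>_. 0) \<and>
           (\<exists>\<phi>. A \<phi> \<and> (\<forall>\<^sub>\<approx>z\<in>disk. \<phi> z = Tz z / T1 z)) \<and>
           (\<forall>\<phi>. A \<phi> \<or> B \<phi> \<or> C \<phi> \<or> D \<phi> \<or> E \<phi> \<or> F \<phi> \<longrightarrow>
              (\<forall>\<^sub>\<approx>z\<in>disk. \<phi> z = Tz z / T1 z)))"
proof -
  interpret nonvanishing_disk_space_operator X N T
    by (intro nonvanishing_disk_space_operator.intro nonvanishing_disk_space_operator_axioms.intro
        disk_space_operator.intro disk_space_operator_axioms.intro assms)
  define A where "A \<phi> \<longleftrightarrow> (\<exists>F. weighted_composition_on X T F \<phi>)" for \<phi>
  define B where "B \<phi> \<longleftrightarrow> hol_self_map \<phi> \<and> (\<forall>f\<in>X. \<forall>z\<in>disk. \<phi> z * T f z = T (shift f) z)" for \<phi>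
  define C where "C \<phi> \<longleftrightarrow> \<phi> meromorphic_on disk \<and>
    (\<forall>f\<in>X. \<forall>\<^sub>\<approx>z\<in>disk. \<phi> z * T f z = T (shift f) z)" for \<phi>
  define D where "D \<phi> \<longleftrightarrow> \<phi> meromorphic_on disk \<and>
    (\<forall>n. \<forall>f\<in>X. \<forall>\<^sub>\<approx>z\<in>disk. \<phi> z ^ n * T f z = T ((shift ^^ n) f) z)" for \<phi>
  define F where "F \<phi> \<longleftrightarrow> hol_self_map \<phi> \<and>
    (\<forall>n. \<forall>z\<in>disk. \<phi> z ^ n * T1 z = T (on_disk (\<lambda>w. w ^ n)) z)" for \<phi>
  define G where "G \<longleftrightarrow> (\<forall>f\<in>X. \<forall>h\<in>X. (\<lambda>z. f z * h z) \<in> X \<longrightarrow>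
    (\<forall>z\<in>disk. T1 z * T (\<lambda>w. f w * h w) z = T f z * T h z))"
  note defs = A_def B_def C_def D_def F_def G_def monomial_symbol_def
  have disk: "\<forall>\<^sub>\<approx>z\<in>disk. z \<in> disk"
    by (rule eventually_in_cosparse) auto
  have mero: "\<phi> meromorphic_on disk" if "hol_self_map \<phi>" for \<phi>
    using that by (auto simp: hol_self_map_def analytic_on_open intro: analytic_on_imp_meromorphic_on)
  \<comment> \<open>The shift conditions and the monomial ones all lead to \<open>monomial_symbol\<close> with the same \<open>\<phi>\<close>, which
     also settles the uniqueness of the symbol; only the way back, \<open>EA\<close>, changes \<open>\<phi>\<close>.\<close>
  have AB: "B \<phi>" if "A \<phi>" for \<phi>
    using that shift_mem by (auto simp: defs weighted_composition_on_def shift_def)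
  have self: "\<phi> z \<in> disk" if "A \<phi>" "z \<in> disk" for \<phi> z
    using that unfolding A_def weighted_composition_on_def hol_self_map_def by blast
  have weight: "T f z = T1 z * f (\<phi> z)" if "A \<phi>" "f \<in> X" "z \<in> disk" for \<phi> f z
  proof -
    obtain W where "\<And>f. f \<in> X \<Longrightarrow> T f z = W z * f (\<phi> z)"
      using \<open>A \<phi>\<close> \<open>z \<in> disk\<close> unfolding A_def weighted_composition_on_def by blast
    from this[OF \<open>f \<in> X\<close>] this[OF one_mem] show ?thesis
      using self[OF \<open>A \<phi>\<close> \<open>z \<in> disk\<close>] by (simp add: on_disk_def)
  qed
  have AF: "F \<phi>" if "A \<phi>" for \<phi>
  proof -
    have "\<phi> z ^ n * T1 z = T (on_disk (\<lambda>w. w ^ n)) z" if "z \<in> disk" for n z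
      using weight[OF \<open>A \<phi>\<close> monomial_mem that, of n] self[OF \<open>A \<phi>\<close> that]
      by (simp add: on_disk_def)
    moreover have "hol_self_map \<phi>"
      using \<open>A \<phi>\<close> unfolding A_def weighted_composition_on_def by blast
    ultimately show ?thesis
      by (simp add: F_def)
  qed
  have AG: G if "A \<phi>" for \<phi>
    unfolding G_def
  proof (intro ballI impI)
    fix f h z
    assume "f \<in> X" "h \<in> X" "(\<lambda>z. f z * h z) \<in> X" "z \<in> disk"
    then show "T1 z * T (\<lambda>w. f w * h w) z = T f z * T h z"
      using weight[OF that, of _ z] by (simp only: mult.left_commute mult.assoc)
  qed
  have BC: "C \<phi>" if "B \<phi>" for \<phi>
    unfolding C_def using that mero disk
    by (auto simp: B_def elim!: eventually_mono)
  have CD: "D \<phi>" if "C \<phi>" for \<phi>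
  proof -
    have "\<forall>\<^sub>\<approx>z\<in>disk. \<phi> z ^ n * T f z = T ((shift ^^ n) f) z" if f: "f \<in> X" for n f
    proof (induction n)
      case (Suc n)
      have "\<forall>\<^sub>\<approx>z\<in>disk. \<phi> z * T ((shift ^^ n) f) z = T (shift ((shift ^^ n) f)) z"
        using \<open>C \<phi>\<close> shift_power_mem[OF f] by (auto simp: C_def)
      with Suc show ?case
        by eventually_elim (simp add: mult.assoc)
    qed simp
    then show ?thesis using \<open>C \<phi>\<close> by (simp add: defs)
  qed
  have DE: "monomial_symbol \<phi>" if "D \<phi>" for \<phi>
    using that one_mem unfolding defs by (metis shift_power_on_disk_one)
  have FE: "monomial_symbol \<phi>" if "F \<phi>" for \<phi>
    unfolding monomial_symbol_def using that mero disk
    by (auto simp: F_def elim!: eventually_mono)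
  have GE: "monomial_symbol (\<lambda>z. Tz z / T1 z)" if G
    using that unfolding G_def by (intro quotient_monomial_symbol_if_multiplicative) auto
  have EA: "\<exists>\<psi>. A \<psi>" if "monomial_symbol \<phi>" for \<phi>
    using self_map_symbol_if_monomial_symbol[OF that] weighted_composition_if_powers unfolding A_def by metis
  have symbol: "monomial_symbol \<phi>" if "A \<phi> \<or> B \<phi> \<or> C \<phi> \<or> D \<phi> \<or> monomial_symbol \<phi> \<or> F \<phi>" for \<phi>
    using that AB BC CD DE FE by blast
  have equiv: "(\<exists>\<phi>. A \<phi>) \<longleftrightarrow> (\<exists>\<phi>. B \<phi>)" "(\<exists>\<phi>. A \<phi>) \<longleftrightarrow> (\<exists>\<phi>. C \<phi>)"
    "(\<exists>\<phi>. A \<phi>) \<longleftrightarrow> (\<exists>\<phi>. D \<phi>)" "(\<exists>\<phi>. A \<phi>) \<longleftrightarrow> (\<exists>\<phi>. monomial_symbol \<phi>)"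
    "(\<exists>\<phi>. A \<phi>) \<longleftrightarrow> (\<exists>\<phi>. F \<phi>)" "(\<exists>\<phi>. A \<phi>) \<longleftrightarrow> G"
    using symbol EA AB BC CD DE AF AG GE by blast+
  have quotient: "T1 \<noteq> (\<lambda>_. 0) \<and> (\<exists>\<phi>. A \<phi> \<and> (\<forall>\<^sub>\<approx>z\<in>disk. \<phi> z = Tz z / T1 z))" if "A \<phi>" for \<phi>
    using that symbol monomial_symbol_eq_quotient image_one_nonzero by blast
  show ?thesis
    unfolding Let_def
    unfolding A_def[symmetric] B_def[symmetric] C_def[symmetric] D_def[symmetric] F_def[symmetric]
      G_def[symmetric] monomial_symbol_def[symmetric]
  proof (intro conjI equiv impI allI)
    assume "(\<exists>\<phi>. A \<phi>) \<or> (\<exists>\<phi>. B \<phi>) \<or> (\<exists>\<phi>. C \<phi>) \<or> (\<exists>\<phi>. D \<phi>) \<or>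
      (\<exists>\<phi>. monomial_symbol \<phi>) \<or> (\<exists>\<phi>. F \<phi>) \<or> G"
    then obtain \<phi> where "A \<phi>" using equiv by metis
    from quotient[OF this] show "T1 \<noteq> (\<lambda>_. 0)"
      "\<exists>\<phi>. A \<phi> \<and> (\<forall>\<^sub>\<approx>z\<in>disk. \<phi> z = Tz z / T1 z)" by blast+
  next
    fix \<phi>
    assume "A \<phi> \<or> B \<phi> \<or> C \<phi> \<or> D \<phi> \<or> monomial_symbol \<phi> \<or> F \<phi>"
    then show "\<forall>\<^sub>\<approx>z\<in>disk. \<phi> z = Tz z / T1 z"
      by (intro monomial_symbol_eq_quotient symbol)
  qed
qed

end
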